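(* Let $1\le k\le d\le n-1$ with $nd$ even and let $1\le\lambda<k$. Consider a distributed storage system $\mathcal{D}(n,k,d)$ equipped with a randomized regular-graph regenerating code over $\mathbb{F}_q$ (built from a $d$-regular graph on $n$ vertices, with $\lambda d-\binom{\lambda}{2}$ of the data units replaced by random units) which is perfectly secure against an adversary of strength at most $\lambda$, and suppose that the encoding matrix $\boldsymbol{G}$ used in the construction is a Cauchy matrix. Then for every $\ell$ with $\lambda<\ell<k$, the code is not perfectly secure against an adversary of strength $\ell$, but it is $b$-block secure against an adversary of strength $\ell$, where $$b=\Big(kd-\binom{k}{2}\Big)-\Big(\ell d-\binom{\ell}{2}\Big)=(k-\ell)\Big(d-\frac{k+\ell-1}{2}\Big).$$
   Context: $\mathbb{F}_q$ is the finite field with $q$ elements, $[n]=\{1,\dots,n\}$, and $\mathcal{M}=kd-\binom{k}{2}$. A DSS $\mathcal{D}(n,k,d)$ has $n$ storage nodes each storing $d$ coded units; the file can be recovered from any $k$ nodes, and a failed node is repaired by downloading one unit from each of $d$ nodes. Randomized regular-graph code with threshold $\lambda$: put $R=\lambda d-\binom{\lambda}{2}$ and $\mathcal{M}^{\mathrm s}=\mathcal{M}-R$. Let $\boldsymbol{X}=(X_1,\dots,X_{\mathcal{M}})$ be a vector of independent uniformly distributed random variables over $\mathbb{F}_q$; a set of $R$ coordinates of $\boldsymbol{X}$ consists of randomly generated units (not part of the file), and the remaining $\mathcal{M}^{\mathrm s}$ coordinates form the file $\boldsymbol{F}=(F_1,\dots,F_{\mathcal{M}^{\mathrm s}})$,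 whose coordinates are the data units. Let $\mathcal{G}$ be a $d$-regular simple graph on vertices $u_1,\dots,u_n$ with edges $e_1,\dots,e_{nd/2}$ (for $d=n-1$ this is the complete graph), and let $\boldsymbol{G}$ be an $(nd/2)\times\mathcal{M}$ matrix over $\mathbb{F}_q$ any $\mathcal{M}$ rows of which are linearly independent. The coded units are $(c_1,\dots,c_{nd/2})^{\mathrm t}=\boldsymbol{G}\boldsymbol{X}^{\mathrm t}$, and Node $i$ stores $c_j$ if and only if $e_j$ is incident to $u_i$. Cauchy matrix: a matrix of the form $\big((x_i+y_j)^{-1}\big)$ with $x_i,y_j\in\mathbb{F}_q$, $x_i+y_j\neq0$ for all $i,j$, the $x_i$ pairwise distinct and the $y_j$ pairwise distinct. Let $\boldsymbol{C}^i$ be the random vector stored at Node $i$. The system is perfectly secure against an adversary of strength $\ell$ ($\ell<k$) if the mutual information $\mathsf{I}\big(\boldsymbol{F};(\boldsymbol{C}^i)_{i\in E}\big)=0$ for all $E\subseteq[n]$ with $|E|\le\ell$. It is $b$-block secure against an adversary of strength $\ell$ if $\mathsf{I}\big((F_j)_{j\in B};(\boldsymbol{C}^i)_{i\in E}\big)=0$ for all $B\subseteq[\mathcal{M}^{\mathrm s}]$ with $|B|\le b$ and all $E\subseteq[n]$ with $|E|\le\ell$.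
   Formalization: Block security is claimed only when λ ≥ 2 or d = n−1; for λ = 1 and d < n−1 it fails for every ℓ with 1 < ℓ < k (e.g. K_{3,3}, k = 3, ℓ = 2: two nodes on one side learn the whole file while b = 1). *)

theory Defs
  imports "HOL-Probability.Information" "Jordan_Normal_Form.Matrix"
begin

(* The set "edges" of two-element subsets of {..<n} is the edge set of a d-regular simple graph. *)
definition regular_simple_graph :: "nat \<Rightarrow> nat \<Rightarrow> nat set set \<Rightarrow> bool" where
  "regular_simple_graph n d edges \<longleftrightarrow>
     edges \<subseteq> {a. a \<subseteq> {..<n} \<and> card a = 2} \<and>
     (\<forall>v<n. card {a \<in> edges. v \<in> a} = d)"

(* The number of edges of a d-regular graph that meet a given clique on m vertices.
   The subtraction on nat does not truncate as long as m \<le> d + 1. *)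
definition clique_units :: "nat \<Rightarrow> nat \<Rightarrow> nat" where
  "clique_units d m = m * d - (m choose 2)"

(* The rows are taken as a family indexed by S, so repeated rows count as dependent. *)
definition any_rows_independent :: "nat \<Rightarrow> 'f::field mat \<Rightarrow> bool" where
  "any_rows_independent m G \<longleftrightarrow>
     (\<forall>S \<subseteq> {..<dim_row G}. card S = m \<longrightarrow>
        (\<forall>c :: nat \<Rightarrow> 'f. (\<forall>j<dim_col G. (\<Sum>i\<in>S. c i * G $$ (i, j)) = 0) \<longrightarrow> (\<forall>i\<in>S. c i = 0)))"

definition cauchy_mat :: "'f::field mat \<Rightarrow> bool" where
  "cauchy_mat G \<longleftrightarrow>
     (\<exists>x y. inj_on x {..<dim_row G} \<and> inj_on y {..<dim_col G} \<and>
        (\<forall>i<dim_row G. \<forall>j<dim_col G. x i + y j \<noteq> 0 \<and> G $$ (i, j) = inverse (x i + y j)))"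

definition iid_uniform :: "'w measure \<Rightarrow> nat \<Rightarrow> (nat \<Rightarrow> 'w \<Rightarrow> 'f::finite) \<Rightarrow> bool" where
  "iid_uniform P m X \<longleftrightarrow>
     prob_space P \<and>
     prob_space.indep_vars P (\<lambda>_. count_space UNIV) X {..<m} \<and>
     (\<forall>j<m. distr P (count_space UNIV) (X j) = uniform_count_measure UNIV)"

definition coded_unit ::
  "'f::semiring_0 mat \<Rightarrow> (nat \<Rightarrow> 'w \<Rightarrow> 'f) \<Rightarrow> nat \<Rightarrow> 'w \<Rightarrow> 'f" where
  "coded_unit G X j \<omega> = (G *\<^sub>v vec (dim_col G) (\<lambda>m. X m \<omega>)) $ j"

(* The random vector stored at node i: the tuple of the coded units c_j with e j incident to i. *)
definition node_content ::
  "(nat \<Rightarrow> nat set) \<Rightarrow> 'f::semiring_0 mat \<Rightarrow> (nat \<Rightarrow> 'w \<Rightarrow> 'f) \<Rightarrow> nat \<Rightarrow> 'w \<Rightarrow> nat \<Rightarrow> 'f" where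
  "node_content e G X i \<omega> = (\<lambda>j \<in> {j. j < dim_row G \<and> i \<in> e j}. coded_unit G X j \<omega>)"

(* Mutual information, in bits, of two random variables with finitely many values. *)
definition mutual_info :: "'w measure \<Rightarrow> ('w \<Rightarrow> 'a) \<Rightarrow> ('w \<Rightarrow> 'b) \<Rightarrow> real" where
  "mutual_info P Y Z =
     prob_space.mutual_information P 2 (count_space (Y ` space P)) (count_space (Z ` space P)) Y Z"

(* In both security notions F 0, ..., F (s - 1) are the data units of the file
   and C i is the content of node i, for i < n. *)
definition perfectly_secure ::
  "'w measure \<Rightarrow> nat \<Rightarrow> nat \<Rightarrow> (nat \<Rightarrow> 'w \<Rightarrow> 'f) \<Rightarrow> (nat \<Rightarrow> 'w \<Rightarrow> 'c) \<Rightarrow> nat \<Rightarrow> bool" where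
  "perfectly_secure P n s F C l \<longleftrightarrow>
     (\<forall>E \<subseteq> {..<n}. card E \<le> l \<longrightarrow>
        mutual_info P (\<lambda>\<omega>. \<lambda>j\<in>{..<s}. F j \<omega>) (\<lambda>\<omega>. \<lambda>i\<in>E. C i \<omega>) = 0)"

definition block_secure ::
  "'w measure \<Rightarrow> nat \<Rightarrow> nat \<Rightarrow> (nat \<Rightarrow> 'w \<Rightarrow> 'f) \<Rightarrow> (nat \<Rightarrow> 'w \<Rightarrow> 'c) \<Rightarrow> nat \<Rightarrow> nat \<Rightarrow> bool" where
  "block_secure P n s F C b l \<longleftrightarrow>
     (\<forall>B \<subseteq> {..<s}. \<forall>E \<subseteq> {..<n}. card B \<le> b \<longrightarrow> card E \<le> l \<longrightarrow>
        mutual_info P (\<lambda>\<omega>. \<lambda>j\<in>B. F j \<omega>) (\<lambda>\<omega>. \<lambda>i\<in>E. C i \<omega>) = 0)"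

(* A randomized regular-graph code D(n,k,d) with threshold lam.  The edges are e 0, e 1, ...;
   the random units are the coordinates of X with index in rnd, and pos enumerates the
   remaining coordinates, so that the j-th data unit of the file is X (pos j).
   For 2 \<le> lam, perfect security at strength lam forces the graph to be complete: a non-clique of
   lam nodes sees more than clique_units d lam independent units.  For lam = 1 every d-regular graph
   qualifies, and if it is not complete, l \<ge> 2 nodes that are not a clique see more than
   clique_units d l units, hence can learn something about
   clique_units d k - clique_units d l data units. *)
definition randomized_rg_code ::
  "'w measure \<Rightarrow> nat \<Rightarrow> nat \<Rightarrow> nat \<Rightarrow> nat \<Rightarrow> nat set set \<Rightarrow> (nat \<Rightarrow> nat set) \<Rightarrow>
   'f::{field,finite} mat \<Rightarrow> (nat \<Rightarrow> 'w \<Rightarrow> 'f) \<Rightarrow> nat set \<Rightarrow> (nat \<Rightarrow> nat) \<Rightarrow> bool" where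
  "randomized_rg_code P n k d lam edges e G X rnd pos \<longleftrightarrow>
     regular_simple_graph n d edges \<and>
     bij_betw e {..<n * d div 2} edges \<and>
     G \<in> carrier_mat (n * d div 2) (clique_units d k) \<and>
     any_rows_independent (clique_units d k) G \<and>
     iid_uniform P (clique_units d k) X \<and>
     rnd \<subseteq> {..<clique_units d k} \<and> card rnd = clique_units d lam \<and>
     bij_betw pos {..<clique_units d k - clique_units d lam} ({..<clique_units d k} - rnd)"

end

theory Submission
  imports Defs
begin

text \<open>
  The units seen by a set \<open>E\<close> of nodes are the images of \<open>X\<close> under the rows of \<open>G\<close> whose edges meet
  \<open>E\<close>; there are at least \<open>clique_units d (card E)\<close> of them, with equality exactly if \<open>E\<close> is a
  clique. If there are more of these rows than random units, some nontrivial combination of them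
  vanishes on the random coordinates, so it is a nonconstant function of the file that the adversary
  can compute. Conversely, all square submatrices of a Cauchy matrix are invertible, so as long as
  the number of observed rows and the size of a block \<open>B\<close> add up to at most the number of columns,
  the values of \<open>X\<close> on \<open>B\<close> can be changed arbitrarily by translations that leave the
  observation fixed; hence block and observation are independent.
\<close>

subsection \<open>Cauchy matrices over finite fields\<close>

lemma cauchy_kernel_trivial:
  fixes x :: "'a \<Rightarrow> 'f::field" and y :: "'b \<Rightarrow> 'f"
  assumes fin: "finite A" "finite B" and inj: "inj_on x A" "inj_on y B"
    and nz: "\<And>i j. i \<in> A \<Longrightarrow> j \<in> B \<Longrightarrow> x i + y j \<noteq> 0"
    and card: "card B \<le> card A"
    and ker: "\<And>i. i \<in> A \<Longrightarrow> (\<Sum>j\<in>B. c j * inverse (x i + y j)) = 0"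
    and b: "b \<in> B"
  shows "c b = 0"
proof -
  \<comment> \<open>The linear relations multiplied by their common denominator: \<open>p\<close> vanishes at every \<open>x i\<close>, which are
    more points than its degree allows, and its value at \<open>- y b\<close> isolates \<open>c b\<close>.\<close>
  define p where "p = (\<Sum>j\<in>B. Polynomial.smult (c j) (\<Prod>j'\<in>B - {j}. [:y j', 1:]))"
  have poly_p: "poly p z = (\<Sum>j\<in>B. c j * (\<Prod>j'\<in>B - {j}. z + y j'))" for z
    by (simp add: p_def poly_sum poly_prod add.commute)
  have deg: "degree p < card B"
  proof -
    have "degree (Polynomial.smult (c j) (\<Prod>j'\<in>B - {j}. [:y j', 1:])) \<le> card B - 1" if "j \<in> B" for j
    proof -
      have "degree (\<Prod>j'\<in>B - {j}. [:y j', 1:]) \<le> (\<Sum>j'\<in>B - {j}. degree [:y j', 1:])"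
        using degree_prod_sum_le[of "B - {j}" "\<lambda>j'. [:y j', 1:]"] fin by (simp add: o_def)
      then show ?thesis
        using that fin by (simp add: card_Diff_singleton)
    qed
    then have "degree p \<le> card B - 1"
      unfolding p_def using fin by (intro degree_sum_le) auto
    moreover have "card B > 0" using b fin card_gt_0_iff by blast
    ultimately show ?thesis by linarith
  qed
  have root: "poly p (x i) = 0" if i: "i \<in> A" for i
  proof -
    have "poly p (x i) = (\<Sum>j\<in>B. (c j * inverse (x i + y j)) * (\<Prod>j'\<in>B. x i + y j'))"
      unfolding poly_p
    proof (rule sum.cong)
      fix j assume j: "j \<in> B"
      have "(\<Prod>j'\<in>B. x i + y j') = (x i + y j) * (\<Prod>j'\<in>B - {j}. x i + y j')"
        using prod.remove[OF fin(2) j] .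
      then show "c j * (\<Prod>j'\<in>B - {j}. x i + y j') =
          (c j * inverse (x i + y j)) * (\<Prod>j'\<in>B. x i + y j')"
        using nz[OF i j] by (simp add: field_simps)
    qed simp
    also have "\<dots> = 0"
      using ker[OF i] by (simp add: sum_distrib_right[symmetric])
    finally show ?thesis .
  qed
  have "p = 0"
  proof (rule poly_eqI_degree[of "x ` A"])
    show "\<And>z. z \<in> x ` A \<Longrightarrow> poly p z = poly 0 z" using root by auto
    show "degree p < card (x ` A)" using deg card inj by (simp add: card_image)
    then show "degree (0::'f poly) < card (x ` A)" by simp
  qed
  then have "0 = poly p (- y b)" by simp
  also have "\<dots> = (\<Sum>j\<in>B. if j = b then c b * (\<Prod>j'\<in>B - {b}. y j' - y b) else 0)"
    unfolding poly_p using fin b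
    by (intro sum.cong) (auto intro!: prod_zero)
  also have "\<dots> = c b * (\<Prod>j'\<in>B - {b}. y j' - y b)"
    using fin b by simp
  \<comment> \<open>The remaining product has no zero factor because \<open>y\<close> is injective
    on \<open>B\<close>.\<close>
  finally show ?thesis
    using fin inj b by (auto simp: inj_on_def)
qed

text \<open>Surjectivity by counting: a square Cauchy system defines an additive map with trivial
  kernel, hence an injection between finite function spaces of equal size, hence a
  bijection.\<close>

lemma cauchy_solvable:
  fixes x :: "'a \<Rightarrow> 'f::{field,finite}" and y :: "'b \<Rightarrow> 'f"
  assumes fin: "finite A" "finite B" and inj: "inj_on x A" "inj_on y B"
    and nz: "\<And>i j. i \<in> A \<Longrightarrow> j \<in> B \<Longrightarrow> x i + y j \<noteq> 0"
    and card: "card A = card B"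
  shows "\<exists>u. \<forall>i\<in>A. (\<Sum>j\<in>B. u j * inverse (x i + y j)) = r i"
proof -
  define T where "T = (\<lambda>u. \<lambda>i\<in>A. \<Sum>j\<in>B. u j * inverse (x i + y j))"
  have "inj_on T (B \<rightarrow>\<^sub>E UNIV)"
  proof (rule inj_onI)
    fix u v assume uv: "u \<in> B \<rightarrow>\<^sub>E UNIV" "v \<in> B \<rightarrow>\<^sub>E UNIV" "T u = T v"
    have "u b = v b" if b: "b \<in> B" for b
    proof -
      have "(\<Sum>j\<in>B. (u j - v j) * inverse (x i + y j)) = 0" if "i \<in> A" for i
        using fun_cong[OF uv(3), of i] that
        by (simp add: T_def left_diff_distrib sum_subtractf)
      from cauchy_kernel_trivial[OF fin inj nz _ this b] card show ?thesis by simp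
    qed
    then show "u = v" using uv by (intro PiE_ext) auto
  qed
  then have "card (T ` (B \<rightarrow>\<^sub>E UNIV)) = card (A \<rightarrow>\<^sub>E (UNIV :: 'f set))"
    using card fin by (simp add: card_image card_funcsetE)
  moreover have "T ` (B \<rightarrow>\<^sub>E UNIV) \<subseteq> A \<rightarrow>\<^sub>E UNIV" by (auto simp: T_def)
  ultimately have "T ` (B \<rightarrow>\<^sub>E UNIV) = A \<rightarrow>\<^sub>E UNIV"
    using fin by (intro card_subset_eq finite_PiE) auto
  moreover have "restrict r A \<in> A \<rightarrow>\<^sub>E UNIV" by auto
  ultimately obtain u where "T u = restrict r A" by (metis imageE)
  then have "\<forall>i\<in>A. T u i = r i" by auto
  then show ?thesis by (auto simp: T_def)
qed

text \<open>Pigeonhole: there are more coefficient families on \<open>A\<close> than value families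
  on \<open>B\<close>, so two of them collide, and their difference is the required family.\<close>

lemma underdetermined_kernel_nontrivial:
  fixes K :: "'a \<Rightarrow> 'b \<Rightarrow> 'f::{field,finite}"
  assumes fin: "finite A" "finite B" and card: "card B < card A"
  shows "\<exists>c. (\<exists>i\<in>A. c i \<noteq> 0) \<and> (\<forall>j\<in>B. (\<Sum>i\<in>A. c i * K i j) = 0)"
proof -
  define T where "T = (\<lambda>u. \<lambda>j\<in>B. \<Sum>i\<in>A. u i * K i j)"
  \<comment> \<open>A field has at least two elements, so powers of its cardinality grow strictly
    with the exponent.\<close>
  have "card (UNIV :: 'f set) \<ge> card {0, 1 :: 'f}" by (rule card_mono) auto
  then have "card (B \<rightarrow>\<^sub>E (UNIV :: 'f set)) < card (A \<rightarrow>\<^sub>E (UNIV :: 'f set))"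
    using fin card by (simp add: card_funcsetE)
  moreover have "T ` (A \<rightarrow>\<^sub>E UNIV) \<subseteq> B \<rightarrow>\<^sub>E UNIV" by (auto simp: T_def)
  ultimately have "\<not> inj_on T (A \<rightarrow>\<^sub>E UNIV)"
    using fin by (metis card_inj_on_le finite_PiE finite leD)
  then obtain u v where uv: "u \<in> A \<rightarrow>\<^sub>E UNIV" "v \<in> A \<rightarrow>\<^sub>E UNIV" "T u = T v" "u \<noteq> v"
    by (auto simp: inj_on_def)
  have "\<exists>i\<in>A. u i \<noteq> v i" using uv PiE_ext by metis
  moreover have "(\<Sum>i\<in>A. (u i - v i) * K i j) = 0" if "j \<in> B" for j
    using fun_cong[OF uv(3), of j] that
    by (simp add: T_def left_diff_distrib sum_subtractf)
  ultimately show ?thesis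
    by (intro exI[of _ "\<lambda>i. u i - v i"]) auto
qed

text \<open>A dimension count gives a nontrivial combination that vanishes on \<open>D\<close>. Were
  it zero on all columns, it would be a dependency among at most \<open>dim_col G\<close> rows of a
  Cauchy matrix, which cannot exist.\<close>

lemma cauchy_mat_row_combination:
  fixes G :: "'f::{field,finite} mat"
  assumes G: "cauchy_mat G" and S: "S \<subseteq> {..<dim_row G}" and D: "D \<subseteq> {..<dim_col G}"
    and card: "card D < card S" "card S \<le> dim_col G"
  shows "\<exists>c. (\<forall>j\<in>D. (\<Sum>i\<in>S. c i * G $$ (i, j)) = 0) \<and>
             (\<exists>j<dim_col G. j \<notin> D \<and> (\<Sum>i\<in>S. c i * G $$ (i, j)) \<noteq> 0)"
proof -
  from G obtain x y where inj: "inj_on x {..<dim_row G}" "inj_on y {..<dim_col G}"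
    and xy: "\<And>i j. i < dim_row G \<Longrightarrow> j < dim_col G \<Longrightarrow> x i + y j \<noteq> 0"
      "\<And>i j. i < dim_row G \<Longrightarrow> j < dim_col G \<Longrightarrow> G $$ (i, j) = inverse (x i + y j)"
    unfolding cauchy_mat_def by auto
  have fin: "finite S" "finite D" using S D finite_subset by auto
  from underdetermined_kernel_nontrivial[OF fin card(1), of "\<lambda>i j. G $$ (i, j)"]
  obtain c i0 where c: "i0 \<in> S" "c i0 \<noteq> 0" "\<forall>j\<in>D. (\<Sum>i\<in>S. c i * G $$ (i, j)) = 0"
    by blast
  have "\<exists>j<dim_col G. (\<Sum>i\<in>S. c i * G $$ (i, j)) \<noteq> 0"
  proof (rule ccontr)
    assume *: "\<not> ?thesis"
    \<comment> \<open>The roles of \<open>x\<close> and \<open>y\<close> are exchanged: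
      \<open>cauchy_kernel_trivial\<close> is aimed at the transpose, which is again Cauchy.\<close>
    have "(\<Sum>i\<in>S. c i * inverse (y j + x i)) = 0" if "j \<in> {..<dim_col G}" for j
    proof -
      have "(\<Sum>i\<in>S. c i * inverse (y j + x i)) = (\<Sum>i\<in>S. c i * G $$ (i, j))"
        using that S xy(2) by (intro sum.cong) (auto simp: add.commute)
      then show ?thesis using * that by auto
    qed
    moreover have "y j + x i \<noteq> 0" if "j \<in> {..<dim_col G}" "i \<in> S" for i j
      using xy(1)[of i j] that S by (auto simp: add.commute)
    ultimately have "c i0 = 0"
      using cauchy_kernel_trivial[of "{..<dim_col G}" S y x c i0] fin inj card c(1) S
      by (auto intro: inj_on_subset)
    with c show False by simp
  qed
  with c show ?thesis by blast
qed

text \<open>This hides a prescribed change on \<open>D\<close> from the rows in \<open>S\<close>: on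
  \<open>card S\<close> further columns a square Cauchy system is solved that cancels the
  contribution of \<open>D\<close>, and all other coordinates are set to zero.\<close>

lemma cauchy_mat_kernel_extension:
  fixes G :: "'f::{field,finite} mat"
  assumes G: "cauchy_mat G" and S: "S \<subseteq> {..<dim_row G}" and D: "D \<subseteq> {..<dim_col G}"
    and card: "card S + card D \<le> dim_col G"
  shows "\<exists>t. (\<forall>j\<in>D. t j = h j) \<and> (\<forall>i\<in>S. (\<Sum>j<dim_col G. G $$ (i, j) * t j) = 0)"
proof -
  from G obtain x y where inj: "inj_on x {..<dim_row G}" "inj_on y {..<dim_col G}"
    and xy: "\<And>i j. i < dim_row G \<Longrightarrow> j < dim_col G \<Longrightarrow> x i + y j \<noteq> 0"
      "\<And>i j. i < dim_row G \<Longrightarrow> j < dim_col G \<Longrightarrow> G $$ (i, j) = inverse (x i + y j)"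
    unfolding cauchy_mat_def by auto
  have fin: "finite S" "finite D" using S D finite_subset by auto
  have "card S \<le> card ({..<dim_col G} - D)"
    using card D fin by (simp add: card_Diff_subset)
  then obtain U where U: "U \<subseteq> {..<dim_col G} - D" "card U = card S" "finite U"
    using obtain_subset_with_card_n by metis
  have "\<exists>u. \<forall>i\<in>S. (\<Sum>j\<in>U. u j * inverse (x i + y j)) = - (\<Sum>j\<in>D. G $$ (i, j) * h j)"
    using S U fin inj xy(1)
    by (intro cauchy_solvable) (auto intro: inj_on_subset)
  then obtain u where u:
    "\<And>i. i \<in> S \<Longrightarrow> (\<Sum>j\<in>U. u j * inverse (x i + y j)) = - (\<Sum>j\<in>D. G $$ (i, j) * h j)"
    by blast
  define t where "t = (\<lambda>j. if j \<in> D then h j else if j \<in> U then u j else 0)"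
  have "(\<Sum>j<dim_col G. G $$ (i, j) * t j) = 0" if i: "i \<in> S" for i
  proof -
    have "(\<Sum>j<dim_col G. G $$ (i, j) * t j) = (\<Sum>j\<in>D \<union> U. G $$ (i, j) * t j)"
      using D U by (intro sum.mono_neutral_right) (auto simp: t_def)
    also have "\<dots> = (\<Sum>j\<in>D. G $$ (i, j) * t j) + (\<Sum>j\<in>U. G $$ (i, j) * t j)"
      using fin U by (intro sum.union_disjoint) auto
    also have "(\<Sum>j\<in>D. G $$ (i, j) * t j) = (\<Sum>j\<in>D. G $$ (i, j) * h j)"
      by (simp add: t_def)
    also have "(\<Sum>j\<in>U. G $$ (i, j) * t j) = (\<Sum>j\<in>U. u j * inverse (x i + y j))"
      using U S i xy(2) by (intro sum.cong) (auto simp: t_def)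
    finally show ?thesis using u[OF i] by simp
  qed
  then show ?thesis by (intro exI[of _ t]) (auto simp: t_def)
qed

subsection \<open>Edges meeting a set of vertices\<close>

text \<open>Keeps the natural-number subtraction in \<open>clique_units\<close> from
  truncating.\<close>

lemma choose_two_le_mult:
  assumes "m \<le> Suc d"
  shows "m choose 2 \<le> m * d"
proof -
  have "m choose 2 \<le> m * (m - 1)" by (simp add: choose_two)
  also have "\<dots> \<le> m * d" using assms by (intro mult_le_mono2) simp
  finally show ?thesis .
qed

text \<open>A further vertex joined to all of an \<open>m\<close>-clique brings \<open>d\<close>
  edges, of which \<open>m\<close> are counted already.\<close>

lemma clique_units_Suc:
  assumes "m \<le> d"
  shows "clique_units d (Suc m) = clique_units d m + (d - m)"
  using assms choose_two_le_mult[of m d] by (simp add: clique_units_def numeral_2_eq_2)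

lemma real_clique_units:
  assumes "m \<le> Suc d"
  shows "real (clique_units d m) = real m * real d - real m * (real m - 1) / 2"
  using assms
proof (induction m)
  case 0
  then show ?case by (simp add: clique_units_def)
next
  case (Suc m)
  then show ?case by (simp add: clique_units_Suc of_nat_diff field_simps)
qed

lemma clique_units_strict_mono:
  assumes "l < m" "m \<le> d"
  shows "clique_units d l < clique_units d m"
  using assms
proof (induction m)
  case (Suc m)
  then show ?case by (cases "l = m") (auto simp: clique_units_Suc)
qed simp

lemma clique_units_mono:
  assumes "l \<le> m" "m \<le> d"
  shows "clique_units d l \<le> clique_units d m"
  using assms clique_units_strict_mono[of l m d] by (cases "l = m") auto

lemma finite_regular_simple_graph: "regular_simple_graph n d edges \<Longrightarrow> finite edges"
  unfolding regular_simple_graph_def by (rule finite_subset[of _ "Pow {..<n}"]) auto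

text \<open>Double counting of the pairs of a vertex of \<open>E\<close> and an edge through it. An
  edge with both ends in \<open>E\<close> is counted twice, once in each summand.\<close>

lemma card_meeting_plus_card_inside:
  assumes reg: "regular_simple_graph n d edges" and E: "E \<subseteq> {..<n}"
  shows "card {a \<in> edges. a \<inter> E \<noteq> {}} + card {a \<in> edges. a \<subseteq> E} = card E * d"
proof -
  have fe: "finite edges" using finite_regular_simple_graph[OF reg] .
  have fE: "finite E" using E finite_subset by auto
  have two: "card a = 2" "finite a" if "a \<in> edges" for a
  proof -
    show "card a = 2" using that reg unfolding regular_simple_graph_def by auto
    then show "finite a" by (simp add: card_ge_0_finite)
  qed
  have "card E * d = (\<Sum>v\<in>E. card {a \<in> edges. v \<in> a})"
    using reg E unfolding regular_simple_graph_def by (simp add: subset_eq)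
  also have "\<dots> = (\<Sum>v\<in>E. \<Sum>a\<in>edges. if v \<in> a then 1 else 0)"
    using fe by (simp add: sum.If_cases Int_def)
  also have "\<dots> = (\<Sum>a\<in>edges. \<Sum>v\<in>E. if v \<in> a then 1 else 0)"
    by (rule sum.swap)
  also have "\<dots> = (\<Sum>a\<in>edges. card (a \<inter> E))"
    using fE by (simp add: sum.If_cases Int_def conj_commute)
  also have "\<dots> = (\<Sum>a\<in>edges. (if a \<inter> E \<noteq> {} then 1 else 0) + (if a \<subseteq> E then 1 else 0))"
  proof (rule sum.cong)
    fix a assume a: "a \<in> edges"
    show "card (a \<inter> E) = (if a \<inter> E \<noteq> {} then 1 else 0) + (if a \<subseteq> E then 1 else 0)"
    proof (cases "a \<subseteq> E")
      case True
      then have "a \<inter> E = a" by auto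
      then show ?thesis using True two[OF a] by auto
    next
      case False
      then have "card (a \<inter> E) < 2" using two[OF a] psubset_card_mono[of a "a \<inter> E"] by auto
      moreover have "card (a \<inter> E) = 0 \<longleftrightarrow> a \<inter> E = {}" using fE by auto
      ultimately show ?thesis using False by auto
    qed
  qed simp
  also have "\<dots> = card {a \<in> edges. a \<inter> E \<noteq> {}} + card {a \<in> edges. a \<subseteq> E}"
    using fe by (simp add: sum.distrib sum.If_cases Int_def)
  finally show ?thesis by simp
qed

text \<open>At most \<open>card E choose 2\<close> edges fit inside \<open>E\<close>, so the double
  count leaves at least the remaining ones meeting \<open>E\<close>.\<close>

lemma clique_units_le_card_meeting:
  assumes reg: "regular_simple_graph n d edges" and E: "E \<subseteq> {..<n}"
  shows "clique_units d (card E) \<le> card {a \<in> edges. a \<inter> E \<noteq> {}}"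
proof -
  have fE: "finite E" using E finite_subset by auto
  have "card {a \<in> edges. a \<subseteq> E} \<le> card {a. a \<subseteq> E \<and> card a = 2}"
    using reg fE unfolding regular_simple_graph_def by (intro card_mono) auto
  then show ?thesis
    using card_meeting_plus_card_inside[OF assms] n_subsets[OF fE, of 2]
    by (simp add: clique_units_def)
qed

lemma clique_units_less_card_meeting:
  assumes reg: "regular_simple_graph n d edges" and E: "E \<subseteq> {..<n}" "card E \<le> d"
    and a: "a \<subseteq> E" "card a = 2" "a \<notin> edges"
  shows "clique_units d (card E) < card {a \<in> edges. a \<inter> E \<noteq> {}}"
proof -
  have fE: "finite E" using E finite_subset by auto
  have "card {a \<in> edges. a \<subseteq> E} < card {a. a \<subseteq> E \<and> card a = 2}"
    using reg fE a unfolding regular_simple_graph_def by (intro psubset_card_mono) auto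
  \<comment> \<open>This rules out truncation in \<open>clique_units\<close>, where the strict
    inequality could be lost.\<close>
  moreover have "card E choose 2 \<le> card E * d"
    using E by (intro choose_two_le_mult) simp
  ultimately show ?thesis
    using card_meeting_plus_card_inside[OF reg E(1)] n_subsets[OF fE, of 2]
    by (simp add: clique_units_def)
qed

lemma card_meeting_eq_clique_units:
  assumes reg: "regular_simple_graph n d edges" and E: "E \<subseteq> {..<n}"
    and complete: "{a. a \<subseteq> {..<n} \<and> card a = 2} \<subseteq> edges"
  shows "card {a \<in> edges. a \<inter> E \<noteq> {}} = clique_units d (card E)"
proof -
  have fE: "finite E" using E finite_subset by auto
  have "{a \<in> edges. a \<subseteq> E} = {a. a \<subseteq> E \<and> card a = 2}"
    using reg complete E unfolding regular_simple_graph_def by auto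
  then show ?thesis
    using card_meeting_plus_card_inside[OF reg E] n_subsets[OF fE, of 2]
    by (simp add: clique_units_def)
qed

text \<open>A vertex has only \<open>n - 1\<close> possible neighbours, so degree
  \<open>n - 1\<close> exhausts them.\<close>

lemma regular_simple_graph_complete:
  assumes reg: "regular_simple_graph n (n - 1) edges"
  shows "{a. a \<subseteq> {..<n} \<and> card a = 2} \<subseteq> edges"
proof safe
  fix a assume a: "a \<subseteq> {..<n}" "card a = 2"
  then obtain u v where uv: "a = {u, v}" "u \<noteq> v" by (auto simp: card_2_iff)
  with a have n: "u < n" "v < n" by auto
  have sub: "{a \<in> edges. u \<in> a} \<subseteq> (\<lambda>w. {u, w}) ` ({..<n} - {u})"
  proof safe
    fix b assume b: "b \<in> edges" "u \<in> b"
    then have "b \<subseteq> {..<n}" "card b = 2" using reg unfolding regular_simple_graph_def by auto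
    then obtain w where "b = {u, w}" "w \<noteq> u" using b by (auto simp: card_2_iff)
    then show "b \<in> (\<lambda>w. {u, w}) ` ({..<n} - {u})" using \<open>b \<subseteq> {..<n}\<close> by auto
  qed
  have "card ((\<lambda>w. {u, w}) ` ({..<n} - {u})) = n - 1"
    using n by (subst card_image) (auto simp: inj_on_def doubleton_eq_iff)
  moreover have "card {a \<in> edges. u \<in> a} = n - 1"
    using reg n unfolding regular_simple_graph_def by auto
  ultimately have "{a \<in> edges. u \<in> a} = (\<lambda>w. {u, w}) ` ({..<n} - {u})"
    using sub by (intro card_subset_eq) auto
  then show "a \<in> edges" using uv n by auto
qed

subsection \<open>Mutual information of functions of a uniform vector\<close>

text \<open>Both criteria below, for zero and for positive information, start from this finite sum
  over the attained pairs of values.\<close>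

lemma (in prob_space) mutual_info_eq_sum:
  assumes Y: "simple_function M Y" and Z: "simple_function M Z"
  shows "mutual_info M Y Z =
    (\<Sum>(y, z)\<in>(\<lambda>w. (Y w, Z w)) ` space M.
       prob {w \<in> space M. Y w = y \<and> Z w = z} *
       log 2 (prob {w \<in> space M. Y w = y \<and> Z w = z} /
         (prob {w \<in> space M. Y w = y} * prob {w \<in> space M. Z w = z})))"
proof -
  interpret information_space M 2 by unfold_locales simp
  have "simple_function M (\<lambda>w. (Y w, Z w))" using Y Z by (rule simple_function_Pair)
  note sd = simple_distributedI[OF this measure_nonneg refl]
  have "mutual_info M Y Z = mutual_information 2 (count_space (Y ` space M)) (count_space (Z ` space M)) Y Z"
    by (simp add: mutual_info_def)
  also have "\<dots> = (\<Sum>(y, z)\<in>(\<lambda>w. (Y w, Z w)) ` space M.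
     prob ((\<lambda>w. (Y w, Z w)) -` {(y, z)} \<inter> space M) *
     log 2 (prob ((\<lambda>w. (Y w, Z w)) -` {(y, z)} \<inter> space M) /
       (prob (Y -` {y} \<inter> space M) * prob (Z -` {z} \<inter> space M))))"
    by (rule mutual_information_simple_distributed[OF simple_distributedI[OF Y measure_nonneg refl]
          simple_distributedI[OF Z measure_nonneg refl] sd])
  also have "\<dots> = (\<Sum>(y, z)\<in>(\<lambda>w. (Y w, Z w)) ` space M.
       prob {w \<in> space M. Y w = y \<and> Z w = z} *
       log 2 (prob {w \<in> space M. Y w = y \<and> Z w = z} /
         (prob {w \<in> space M. Y w = y} * prob {w \<in> space M. Z w = z})))"
    by (simp add: vimage_def Int_def conj_commute)
  finally show ?thesis .
qed

text \<open>Under factorisation each summand either has probability zero as a factor or contains the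
  logarithm of 1.\<close>

lemma (in prob_space) mutual_info_eq_0:
  assumes Y: "simple_function M Y" and Z: "simple_function M Z"
    and indep: "\<And>w. w \<in> space M \<Longrightarrow>
      prob {v \<in> space M. Y v = Y w \<and> Z v = Z w} =
      prob {v \<in> space M. Y v = Y w} * prob {v \<in> space M. Z v = Z w}"
  shows "mutual_info M Y Z = 0"
  unfolding mutual_info_eq_sum[OF Y Z]
  by (intro sum.neutral) (auto simp: indep)

lemma (in prob_space) sum_prob_simple_function:
  assumes "simple_function M Y"
  shows "(\<Sum>y\<in>Y ` space M. prob {w \<in> space M. Y w = y}) = 1"
proof -
  have "(\<Sum>y\<in>Y ` space M. prob (Y -` {y} \<inter> space M)) = 1"
    by (rule simple_distributed_sum_space[OF simple_distributedI[OF assms measure_nonneg refl]])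
  then show ?thesis by (simp add: vimage_def Int_def conj_commute)
qed

text \<open>The missing pair of values makes Gibbs' inequality strict.\<close>

lemma (in prob_space) mutual_info_pos:
  assumes Y: "simple_function M Y" and Z: "simple_function M Z"
    and pos: "prob {w \<in> space M. Y w = a} > 0" "prob {w \<in> space M. Z w = c} > 0"
    and empty: "\<And>w. w \<in> space M \<Longrightarrow> \<not> (Y w = a \<and> Z w = c)"
  shows "mutual_info M Y Z > 0"
proof -
  let ?I = "(\<lambda>w. (Y w, Z w)) ` space M" and ?K = "Y ` space M \<times> Z ` space M"
  let ?q = "\<lambda>y. prob {w \<in> space M. Y w = y}" and ?r = "\<lambda>z. prob {w \<in> space M. Z w = z}"
  let ?p = "\<lambda>y z. prob {w \<in> space M. Y w = y \<and> Z w = z}"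
  have fin: "finite ?K" using Y Z by (auto simp: simple_function_def)
  have YZ: "simple_function M (\<lambda>w. (Y w, Z w))" using Y Z by (rule simple_function_Pair)
  have ac: "a \<in> Y ` space M" "c \<in> Z ` space M"
  proof -
    have "{w \<in> space M. Y w = a} \<noteq> {}" "{w \<in> space M. Z w = c} \<noteq> {}"
      using pos by (metis measure_empty less_irrefl)+
    then show "a \<in> Y ` space M" "c \<in> Z ` space M" by auto
  qed
  have mY: "{w \<in> space M. Y w = y} \<in> events" for y
    using simple_functionD(2)[OF Y, of "{y}"] by (simp add: vimage_def Int_def conj_commute)
  have mZ: "{w \<in> space M. Z w = z} \<in> events" for z
    using simple_functionD(2)[OF Z, of "{z}"] by (simp add: vimage_def Int_def conj_commute)
  have sump: "(\<Sum>(y, z)\<in>?I. ?p y z) = 1"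
    using sum_prob_simple_function[OF YZ] by (simp add: case_prod_unfold prod_eq_iff)
  have sumqr: "(\<Sum>(y, z)\<in>?K. ?q y * ?r z) = 1"
    using sum_prob_simple_function[OF Y] sum_prob_simple_function[OF Z]
    by (simp add: sum.cartesian_product[symmetric] sum_distrib_left[symmetric])
  \<comment> \<open>The pair \<open>(a, c)\<close> is not attained, so the product distribution puts
    at least \<open>?q a * ?r c\<close> outside \<open>?I\<close>, whereas the joint distribution
    has all its mass on \<open>?I\<close>.\<close>
  have "?q a * ?r c + (\<Sum>(y, z)\<in>?I. ?q y * ?r z) = (\<Sum>(y, z)\<in>insert (a, c) ?I. ?q y * ?r z)"
    using empty finite_subset[OF _ fin, of ?I] by (subst sum.insert) auto
  also have "\<dots> \<le> (\<Sum>(y, z)\<in>?K. ?q y * ?r z)"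
    using fin ac by (intro sum_mono2) auto
  finally have 1: "?q a * ?r c + (\<Sum>(y, z)\<in>?I. ?q y * ?r z) \<le> 1"
    using sumqr by simp
  \<comment> \<open>Termwise Gibbs bound, from \<open>ln t \<le> t - 1\<close> at
    \<open>t = ?q y * ?r z / ?p y z\<close>. The factor \<open>ln 2\<close> converts bits to natural
    logarithms.\<close>
  have gibbs: "?p y z - ?q y * ?r z \<le> ln 2 * (?p y z * log 2 (?p y z / (?q y * ?r z)))" for y z
  proof (cases "?p y z = 0")
    case True
    then show ?thesis by simp
  next
    case False
    then have p: "?p y z > 0" using zero_less_measure_iff by blast
    have "?p y z \<le> ?q y" "?p y z \<le> ?r z"
      using mY mZ by (auto intro!: finite_measure_mono)
    with p have q: "?q y > 0" "?r z > 0" by auto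
    have "ln (?q y * ?r z / ?p y z) \<le> ?q y * ?r z / ?p y z - 1"
      using p q by (intro ln_le_minus_one) auto
    then have "?p y z * ln (?q y * ?r z / ?p y z) \<le> ?p y z * (?q y * ?r z / ?p y z - 1)"
      using p by (intro mult_left_mono) auto
    also have "\<dots> = ?q y * ?r z - ?p y z"
      using p by (simp add: right_diff_distrib)
    also have "ln (?q y * ?r z / ?p y z) = - ln (?p y z / (?q y * ?r z))"
      using p q by (simp add: ln_div)
    finally show ?thesis by (simp add: log_def)
  qed
  have "0 < ?q a * ?r c" using pos by simp
  also have "\<dots> \<le> (\<Sum>(y, z)\<in>?I. ?p y z) - (\<Sum>(y, z)\<in>?I. ?q y * ?r z)"
    using 1 sump by simp
  also have "\<dots> = (\<Sum>(y, z)\<in>?I. ?p y z - ?q y * ?r z)"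
    by (simp add: sum_subtractf case_prod_unfold)
  also have "\<dots> \<le> (\<Sum>(y, z)\<in>?I. ln 2 * (?p y z * log 2 (?p y z / (?q y * ?r z))))"
    using gibbs by (intro sum_mono) auto
  also have "\<dots> = ln 2 * mutual_info M Y Z"
    unfolding mutual_info_eq_sum[OF Y Z] by (simp add: sum_distrib_left case_prod_unfold)
  finally show ?thesis by (simp add: zero_less_mult_iff)
qed

section \<open>Uniform vectors: probabilities as counts\<close>

lemma iid_uniform_measurable:
  assumes "iid_uniform P m X" "j < m"
  shows "X j \<in> measurable P (count_space UNIV)"
proof -
  interpret prob_space P using assms by (simp add: iid_uniform_def)
  show ?thesis using assms by (auto simp: iid_uniform_def indep_vars_def)
qed

text \<open>The restricted vector takes finitely many values, each on a measurable event, so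
  composition with an arbitrary \<open>f\<close> stays simple.\<close>

lemma iid_uniform_simple_function:
  fixes X :: "nat \<Rightarrow> 'w \<Rightarrow> 'f::finite"
  assumes "iid_uniform P m X"
  shows "simple_function P (\<lambda>w. f (\<lambda>j\<in>{..<m}. X j w))"
proof -
  let ?V = "\<lambda>w. \<lambda>j\<in>{..<m}. X j w"
  have fin: "finite ({..<m} \<rightarrow>\<^sub>E (UNIV :: 'f set))" by (intro finite_PiE) auto
  have "?V -` {v} \<inter> space P \<in> sets P" if "v \<in> {..<m} \<rightarrow>\<^sub>E UNIV" for v
  proof -
    have "?V w = v \<longleftrightarrow> (\<forall>j\<in>{..<m}. X j w = v j)" for w
      using that by (auto intro!: ext simp: PiE_def extensional_def restrict_def)
    then have "?V -` {v} \<inter> space P = {w \<in> space P. \<forall>j\<in>{..<m}. X j w = v j}"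
      by auto
    also have "\<dots> \<in> sets P"
    proof (intro sets.sets_Collect_finite_All)
      fix j assume "j \<in> {..<m}"
      then have "X j -` {v j} \<inter> space P \<in> sets P"
        using iid_uniform_measurable[OF assms, of j] by (auto intro: measurable_sets)
      then show "{w \<in> space P. X j w = v j} \<in> sets P"
        by (simp add: vimage_def Int_def conj_commute)
    qed auto
    finally show ?thesis .
  qed
  moreover have V: "?V ` space P \<subseteq> {..<m} \<rightarrow>\<^sub>E UNIV"
    by (intro image_subsetI) (simp add: restrict_PiE_iff)
  ultimately have "simple_function P ?V"
    unfolding simple_function_def using finite_subset[OF V fin] by auto
  then show ?thesis using simple_function_compose[of P ?V f] by (simp add: o_def)
qed

lemma prob_iid_uniform_eq:
  fixes X :: "nat \<Rightarrow> 'w \<Rightarrow> 'f::finite"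
  assumes iid: "iid_uniform P m X"
  shows "measure P {w \<in> space P. \<forall>j<m. X j w = v j} = 1 / real (CARD('f) ^ m)"
\<comment> \<open>The product rule for independent events is used on a nonempty index set; for
  \<open>m = 0\<close> the event is the whole space.\<close>
proof (cases "m = 0")
  case True
  then show ?thesis
    using iid prob_space.prob_space[of P] by (simp add: iid_uniform_def)
next
  case False
  interpret prob_space P using iid by (simp add: iid_uniform_def)
  have single: "prob (X j -` {v j} \<inter> space P) = 1 / real CARD('f)" if "j < m" for j
  proof -
    have "prob (X j -` {v j} \<inter> space P) = measure (distr P (count_space UNIV) (X j)) {v j}"
      using iid_uniform_measurable[OF iid that] by (simp add: measure_distr)
    also have "\<dots> = measure (uniform_count_measure UNIV) {v j}"
      using iid that by (simp add: iid_uniform_def)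
    also have "\<dots> = 1 / real CARD('f)"
      by (subst measure_uniform_count_measure) auto
    finally show ?thesis .
  qed
  have "prob (\<Inter>j\<in>{..<m}. X j -` {v j} \<inter> space P) = (\<Prod>j\<in>{..<m}. prob (X j -` {v j} \<inter> space P))"
    using iid False by (intro indep_varsD_finite) (auto simp: iid_uniform_def)
  also have "\<dots> = 1 / real (CARD('f) ^ m)"
    by (simp add: single power_one_over)
  also have "(\<Inter>j\<in>{..<m}. X j -` {v j} \<inter> space P) = {w \<in> space P. \<forall>j<m. X j w = v j}"
    using False by auto
  finally show ?thesis .
qed

lemma prob_iid_uniform:
  fixes X :: "nat \<Rightarrow> 'w \<Rightarrow> 'f::finite"
  assumes iid: "iid_uniform P m X"
  shows "measure P {w \<in> space P. Q (\<lambda>j\<in>{..<m}. X j w)} =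
    real (card {v \<in> {..<m} \<rightarrow>\<^sub>E UNIV. Q v}) / real (CARD('f) ^ m)"
proof -
  interpret prob_space P using iid by (simp add: iid_uniform_def)
  let ?V = "\<lambda>w. \<lambda>j\<in>{..<m}. X j w" and ?A = "{v \<in> {..<m} \<rightarrow>\<^sub>E (UNIV :: 'f set). Q v}"
  have fin: "finite ?A" using finite_PiE[of "{..<m}" "\<lambda>_. UNIV :: 'f set"] by simp
  have "{w \<in> space P. Q (?V w)} = (\<Union>v\<in>?A. {w \<in> space P. ?V w = v})" by auto
  also have "prob \<dots> = (\<Sum>v\<in>?A. prob {w \<in> space P. ?V w = v})"
  proof (rule finite_measure_finite_Union[OF fin])
    have "?V -` {v} \<inter> space P \<in> events" for v
      by (rule simple_functionD(2)[OF iid_uniform_simple_function[OF iid, of id, simplified]])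
    then show "(\<lambda>v. {w \<in> space P. ?V w = v}) ` ?A \<subseteq> events"
      by (auto simp: vimage_def Int_def conj_commute)
  qed (auto simp: disjoint_family_on_def)
  also have "\<dots> = (\<Sum>v\<in>?A. 1 / real (CARD('f) ^ m))"
  proof (rule sum.cong)
    fix v assume "v \<in> ?A"
    then have "?V w = v \<longleftrightarrow> (\<forall>j<m. X j w = v j)" for w
      by (auto intro!: ext simp: PiE_def extensional_def restrict_def)
    then show "prob {w \<in> space P. ?V w = v} = 1 / real (CARD('f) ^ m)"
      using prob_iid_uniform_eq[OF iid, of v] by simp
  qed simp
  finally show ?thesis by simp
qed

section \<open>Independence and dependence by counting fibres\<close>

lemma card_Collect_eq_sum_fibres:
  assumes "finite V"
  shows "card {v \<in> V. Q v} = (\<Sum>c\<in>h ` V. card {v \<in> V. h v = c \<and> Q v})"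
proof -
  have "{v \<in> V. Q v} = (\<Union>c\<in>h ` V. {v \<in> V. h v = c \<and> Q v})" by auto
  also have "card \<dots> = (\<Sum>c\<in>h ` V. card {v \<in> V. h v = c \<and> Q v})"
    using assms by (intro card_UN_disjoint) auto
  finally show ?thesis .
qed

text \<open>Counting form of independence. The maps \<open>\<tau>\<close> carry the cell of a value
  of \<open>f\<close> into the cell of any other value without changing \<open>g\<close>, so inside
  each fibre of \<open>g\<close> all values of \<open>f\<close> are equally frequent.\<close>

lemma card_fibre_product:
  assumes fin: "finite V"
    and move: "\<And>a a'. a \<in> f ` V \<Longrightarrow> a' \<in> f ` V \<Longrightarrow>
      \<exists>\<tau>. inj_on \<tau> V \<and> \<tau> ` V \<subseteq> V \<and> (\<forall>v\<in>V. g (\<tau> v) = g v \<and> (f v = a \<longrightarrow> f (\<tau> v) = a'))"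
    and a: "a \<in> f ` V"
  shows "card {v \<in> V. f v = a \<and> g v = b} * card V =
    card {v \<in> V. f v = a} * card {v \<in> V. g v = b}"
proof -
  let ?N = "\<lambda>a b. card {v \<in> V. f v = a \<and> g v = b}"
  have le: "?N a b \<le> ?N a' b" if "a \<in> f ` V" "a' \<in> f ` V" for a a' b
  proof -
    from move[OF that] obtain \<tau> where t: "inj_on \<tau> V" "\<tau> ` V \<subseteq> V"
      "\<And>v. v \<in> V \<Longrightarrow> g (\<tau> v) = g v" "\<And>v. v \<in> V \<Longrightarrow> f v = a \<Longrightarrow> f (\<tau> v) = a'" by blast
    show ?thesis
      using t fin by (intro card_inj_on_le[of \<tau>]) (auto intro: inj_on_subset)
  qed
  \<comment> \<open>Moves in both directions give the two inequalities between the cell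
    sizes.\<close>
  have eq: "?N a' b = ?N a b" if "a' \<in> f ` V" for a' b
    using le[OF that a, of b] le[OF a that, of b] by simp
  note part = card_Collect_eq_sum_fibres[OF fin]
  \<comment> \<open>A fibre of \<open>g\<close> splits into cells of equal size, one for each value
    of \<open>f\<close>; below, \<open>V\<close> splits in the same way into equal fibres of
    \<open>f\<close>.\<close>
  have g: "card {v \<in> V. g v = b} = card (f ` V) * ?N a b"
    using part[where Q = "\<lambda>v. g v = b" and h = f] eq by simp
  have f: "card {v \<in> V. f v = a'} = card {v \<in> V. f v = a}" if "a' \<in> f ` V" for a'
    using part[where Q = "\<lambda>v. f v = a'" and h = g] part[where Q = "\<lambda>v. f v = a" and h = g] eq[OF that]
    by (simp add: conj_commute)
  have "card V = card (f ` V) * card {v \<in> V. f v = a}"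
    using part[where Q = "\<lambda>v. True" and h = f] f by simp
  with g show ?thesis by simp
qed

lemma mutual_info_iid_uniform_eq_0:
  fixes X :: "nat \<Rightarrow> 'w \<Rightarrow> 'f::finite"
  assumes iid: "iid_uniform P m X"
    and move: "\<And>a a'. a \<in> f ` ({..<m} \<rightarrow>\<^sub>E UNIV) \<Longrightarrow> a' \<in> f ` ({..<m} \<rightarrow>\<^sub>E UNIV) \<Longrightarrow>
      \<exists>\<tau>. inj_on \<tau> ({..<m} \<rightarrow>\<^sub>E UNIV) \<and> \<tau> ` ({..<m} \<rightarrow>\<^sub>E UNIV) \<subseteq> {..<m} \<rightarrow>\<^sub>E UNIV \<and>
        (\<forall>v\<in>{..<m} \<rightarrow>\<^sub>E UNIV. g (\<tau> v) = g v \<and> (f v = a \<longrightarrow> f (\<tau> v) = a'))"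
  shows "mutual_info P (\<lambda>w. f (\<lambda>j\<in>{..<m}. X j w)) (\<lambda>w. g (\<lambda>j\<in>{..<m}. X j w)) = 0"
proof -
  interpret prob_space P using iid by (simp add: iid_uniform_def)
  let ?V = "{..<m} \<rightarrow>\<^sub>E (UNIV :: 'f set)"
  have fin: "finite ?V" by (intro finite_PiE) auto
  have card: "card ?V = CARD('f) ^ m" by (simp add: card_funcsetE)
  show ?thesis
  proof (rule mutual_info_eq_0[OF iid_uniform_simple_function[OF iid] iid_uniform_simple_function[OF iid]])
    fix w
    let ?u = "\<lambda>j\<in>{..<m}. X j w"
    have cross: "real (card {v \<in> ?V. f v = f ?u \<and> g v = g ?u} * card ?V) =
        real (card {v \<in> ?V. f v = f ?u} * card {v \<in> ?V. g v = g ?u})"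
      by (subst card_fibre_product[OF fin move]) auto
    \<comment> \<open>Dividing the count identity by the square of \<open>card ?V\<close> gives the
      product rule for probabilities.\<close>
    have div: "p / q = (r / q) * (s / q)" if "p * q = r * s" "q \<noteq> 0" for p q r s :: real
      using that by (simp add: times_divide_times_eq that(1)[symmetric])
    show "prob {v \<in> space P. f (\<lambda>j\<in>{..<m}. X j v) = f ?u \<and> g (\<lambda>j\<in>{..<m}. X j v) = g ?u} =
        prob {v \<in> space P. f (\<lambda>j\<in>{..<m}. X j v) = f ?u} * prob {v \<in> space P. g (\<lambda>j\<in>{..<m}. X j v) = g ?u}"
      unfolding prob_iid_uniform[OF iid, of "\<lambda>v. f v = f ?u \<and> g v = g ?u"]
        prob_iid_uniform[OF iid, of "\<lambda>v. f v = f ?u"] prob_iid_uniform[OF iid, of "\<lambda>v. g v = g ?u"]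
      using cross by (intro div) (simp_all add: card)
  qed
qed

text \<open>The values \<open>f u\<close> and \<open>g u'\<close> each have positive probability,
  being attained on the cube, but never occur together.\<close>

lemma mutual_info_iid_uniform_pos:
  fixes X :: "nat \<Rightarrow> 'w \<Rightarrow> 'f::finite"
  assumes iid: "iid_uniform P m X"
    and u: "u \<in> {..<m} \<rightarrow>\<^sub>E UNIV" "u' \<in> {..<m} \<rightarrow>\<^sub>E UNIV"
    and excl: "\<And>v. v \<in> {..<m} \<rightarrow>\<^sub>E UNIV \<Longrightarrow> \<not> (f v = f u \<and> g v = g u')"
  shows "mutual_info P (\<lambda>w. f (\<lambda>j\<in>{..<m}. X j w)) (\<lambda>w. g (\<lambda>j\<in>{..<m}. X j w)) > 0"
proof -
  interpret prob_space P using iid by (simp add: iid_uniform_def)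
  let ?V = "{..<m} \<rightarrow>\<^sub>E (UNIV :: 'f set)"
  have fin: "finite {v \<in> ?V. Q v}" for Q
    using finite_PiE[of "{..<m}" "\<lambda>_. UNIV :: 'f set"] by simp
  have "card {v \<in> ?V. f v = f u} > 0" "card {v \<in> ?V. g v = g u'} > 0"
    using fin u by (auto simp: card_gt_0_iff)
  then have "prob {w \<in> space P. f (\<lambda>j\<in>{..<m}. X j w) = f u} > 0"
      "prob {w \<in> space P. g (\<lambda>j\<in>{..<m}. X j w) = g u'} > 0"
    using prob_iid_uniform[OF iid, of "\<lambda>v. f v = f u"] prob_iid_uniform[OF iid, of "\<lambda>v. g v = g u'"]
    by simp_all
  then show ?thesis
    by (rule mutual_info_pos[OF iid_uniform_simple_function[OF iid] iid_uniform_simple_function[OF iid]])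
      (rule excl, subst restrict_PiE_iff, simp)
qed

subsection \<open>What an adversary learns\<close>

lemma coded_unit_eq_sum:
  "j < dim_row G \<Longrightarrow> coded_unit G X j w = (\<Sum>m<dim_col G. G $$ (j, m) * X m w)"
  by (simp add: coded_unit_def scalar_prod_def lessThan_atLeast0)

text \<open>Reduces nested tuples to the set of observed units, so that a unit stored at two nodes
  of \<open>E\<close> counts once. Allowing different \<open>X\<close> and \<open>Y\<close> lets it
  also compare a random vector at a sample point with a fixed vector.\<close>

lemma node_contents_eq_iff:
  "(\<lambda>i\<in>E. node_content e G X i w) = (\<lambda>i\<in>E. node_content e G Y i w') \<longleftrightarrow>
   (\<forall>j<dim_row G. e j \<inter> E \<noteq> {} \<longrightarrow> coded_unit G X j w = coded_unit G Y j w')"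
  (is "?L = ?R \<longleftrightarrow> ?P")
proof
  assume eq: "?L = ?R"
  show ?P
  proof (intro allI impI)
    fix j assume j: "j < dim_row G" "e j \<inter> E \<noteq> {}"
    then obtain i where i: "i \<in> E" "i \<in> e j" by auto
    from fun_cong[OF fun_cong[OF eq, of i], of j] i j
    show "coded_unit G X j w = coded_unit G Y j w'" by (simp add: node_content_def)
  qed
next
  assume ?P
  then show "?L = ?R" by (auto simp: node_content_def restrict_def fun_eq_iff)
qed

text \<open>Presents the observation as a function of the coordinate vector alone: with
  \<open>\<lambda>m v. v m\<close> in place of \<open>X\<close>, the vector itself is the sample
  point.\<close>

lemma node_contents_restrict:
  "(\<lambda>i\<in>E. node_content e G X i w) =
   (\<lambda>i\<in>E. node_content e G (\<lambda>m v. v m) i (\<lambda>m\<in>{..<dim_col G}. X m w))"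
  unfolding node_contents_eq_iff by (simp add: coded_unit_eq_sum)

text \<open>\<open>D\<close> stands for the masking coordinates. Observing more than
  \<open>card D\<close> rows allows the masks to be eliminated, which leaves a nonzero linear
  functional of the data.\<close>

lemma mutual_info_node_contents_pos:
  fixes G :: "'f::{field,finite} mat"
  assumes iid: "iid_uniform P (dim_col G) X" and G: "cauchy_mat G"
    and D: "D \<subseteq> {..<dim_col G}" "pos ` B = {..<dim_col G} - D"
    and card: "card D < card {j. j < dim_row G \<and> e j \<inter> E \<noteq> {}}" "card D < dim_col G"
  shows "mutual_info P (\<lambda>w. \<lambda>j\<in>B. X (pos j) w) (\<lambda>w. \<lambda>i\<in>E. node_content e G X i w) > 0"
proof -
  let ?m = "dim_col G"
  \<comment> \<open>One row more than there are masks: enough for elimination, and still at most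
    \<open>dim_col G\<close> rows, as \<open>cauchy_mat_row_combination\<close> requires.\<close>
  obtain S where S: "S \<subseteq> {j. j < dim_row G \<and> e j \<inter> E \<noteq> {}}" "card S = Suc (card D)" "finite S"
    using obtain_subset_with_card_n[OF Suc_leI[OF card(1)]] by blast
  from S have "S \<subseteq> {..<dim_row G}" by auto
  from cauchy_mat_row_combination[OF G this D(1)] S card
  obtain c j0 where c: "\<And>m. m \<in> D \<Longrightarrow> (\<Sum>i\<in>S. c i * G $$ (i, m)) = 0"
    and j0: "j0 < ?m" "j0 \<notin> D" "(\<Sum>i\<in>S. c i * G $$ (i, j0)) \<noteq> 0"
    by auto
  define L where "L = (\<lambda>v :: nat \<Rightarrow> 'f. \<Sum>m\<in>{..<?m} - D. (\<Sum>i\<in>S. c i * G $$ (i, m)) * v m)"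
  have L: "(\<Sum>i\<in>S. c i * coded_unit G (\<lambda>m v. v m) i v) = L v" for v :: "nat \<Rightarrow> 'f"
  proof -
    have "(\<Sum>i\<in>S. c i * coded_unit G (\<lambda>m v. v m) i v) =
        (\<Sum>i\<in>S. \<Sum>m<?m. c i * G $$ (i, m) * v m)"
      using S by (intro sum.cong) (auto simp: coded_unit_eq_sum sum_distrib_left mult.assoc)
    also have "\<dots> = (\<Sum>m<?m. (\<Sum>i\<in>S. c i * G $$ (i, m)) * v m)"
      by (subst sum.swap) (simp add: sum_distrib_right)
    also have "\<dots> = L v"
      unfolding L_def using D c by (intro sum.mono_neutral_right) auto
    finally show ?thesis .
  qed
  define f :: "(nat \<Rightarrow> 'f) \<Rightarrow> _ \<Rightarrow> 'f" where "f = (\<lambda>v. \<lambda>j\<in>B. v (pos j))"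
  define g where "g = (\<lambda>v :: nat \<Rightarrow> 'f. \<lambda>i\<in>E. node_content e G (\<lambda>m v. v m) i v)"
  \<comment> \<open>The data of the unit vector \<open>u\<close> force \<open>L\<close> to be
    nonzero, the observation of the zero vector \<open>z\<close> forces it to be zero, so the two
    values exclude each other.\<close>
  define u :: "nat \<Rightarrow> 'f" where "u = (\<lambda>m\<in>{..<?m}. if m = j0 then 1 else 0)"
  define z :: "nat \<Rightarrow> 'f" where "z = (\<lambda>m\<in>{..<?m}. 0)"
  have Lu: "L u \<noteq> 0"
  proof -
    have "L u = (\<Sum>m\<in>{..<?m} - D. if m = j0 then (\<Sum>i\<in>S. c i * G $$ (i, j0)) else 0)"
      unfolding L_def by (intro sum.cong) (auto simp: u_def)
    then show ?thesis using j0 by simp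
  qed
  have "mutual_info P (\<lambda>w. f (\<lambda>j\<in>{..<?m}. X j w)) (\<lambda>w. g (\<lambda>j\<in>{..<?m}. X j w)) > 0"
  proof (rule mutual_info_iid_uniform_pos[OF iid])
    show "u \<in> {..<?m} \<rightarrow>\<^sub>E UNIV" "z \<in> {..<?m} \<rightarrow>\<^sub>E UNIV" by (auto simp: u_def z_def)
    fix v :: "nat \<Rightarrow> 'f"
    show "\<not> (f v = f u \<and> g v = g z)"
    proof
      assume *: "f v = f u \<and> g v = g z"
      have "v m = u m" if m: "m \<in> {..<?m} - D" for m
      proof -
        from m D(2) obtain j where "j \<in> B" "m = pos j" by blast
        moreover have "f v j = f u j" using * by simp
        ultimately show ?thesis by (simp add: f_def)
      qed
      then have "L v = L u" by (simp add: L_def)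
      moreover have "coded_unit G (\<lambda>m v. v m) i v = coded_unit G (\<lambda>m v. v m) i z" if "i \<in> S" for i
        using that S * by (auto simp: g_def node_contents_eq_iff)
      then have "L v = L z" by (simp add: L[symmetric])
      moreover have "L z = 0" by (simp add: L_def z_def)
      ultimately show False using Lu by simp
    qed
  qed
  moreover have "f (\<lambda>m\<in>{..<?m}. X m w) = (\<lambda>j\<in>B. X (pos j) w)" for w
    using D(2) by (auto simp: f_def fun_eq_iff restrict_def)
  ultimately show ?thesis
    unfolding g_def node_contents_restrict[symmetric] by simp
qed

lemma mutual_info_node_contents_eq_0:
  fixes G :: "'f::{field,finite} mat"
  assumes iid: "iid_uniform P (dim_col G) X" and G: "cauchy_mat G"
    and B: "finite B" "inj_on pos B" "pos ` B \<subseteq> {..<dim_col G}"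
    and card: "card {j. j < dim_row G \<and> e j \<inter> E \<noteq> {}} + card B \<le> dim_col G"
  shows "mutual_info P (\<lambda>w. \<lambda>j\<in>B. X (pos j) w) (\<lambda>w. \<lambda>i\<in>E. node_content e G X i w) = 0"
proof -
  let ?m = "dim_col G" and ?S = "{j. j < dim_row G \<and> e j \<inter> E \<noteq> {}}"
  define f :: "(nat \<Rightarrow> 'f) \<Rightarrow> _ \<Rightarrow> 'f" where "f = (\<lambda>v. \<lambda>j\<in>B. v (pos j))"
  define g where "g = (\<lambda>v :: nat \<Rightarrow> 'f. \<lambda>i\<in>E. node_content e G (\<lambda>m v. v m) i v)"
  have "mutual_info P (\<lambda>w. f (\<lambda>j\<in>{..<?m}. X j w)) (\<lambda>w. g (\<lambda>j\<in>{..<?m}. X j w)) = 0"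
  proof (rule mutual_info_iid_uniform_eq_0[OF iid])
    fix a a' assume a: "a \<in> f ` ({..<?m} \<rightarrow>\<^sub>E UNIV)" "a' \<in> f ` ({..<?m} \<rightarrow>\<^sub>E UNIV)"
    \<comment> \<open>The translation \<open>t\<close> turns block \<open>a\<close> into
      \<open>a'\<close> and lies in the kernel of every observed row. \<open>inv_into\<close>
      recovers the block index from a coordinate.\<close>
    have "\<exists>t. (\<forall>m\<in>pos ` B. t m = a' (inv_into B pos m) - a (inv_into B pos m)) \<and>
        (\<forall>i\<in>?S. (\<Sum>m<?m. G $$ (i, m) * t m) = 0)"
      using card B by (intro cauchy_mat_kernel_extension[OF G]) (auto simp: card_image)
    then obtain t where t: "\<forall>m\<in>pos ` B. t m = a' (inv_into B pos m) - a (inv_into B pos m)"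
      "\<forall>i\<in>?S. (\<Sum>m<?m. G $$ (i, m) * t m) = 0"
      by blast
    have t_pos: "t (pos j) = a' j - a j" if "j \<in> B" for j
      using t(1) that B(2) by simp
    define \<tau> where "\<tau> = (\<lambda>v. \<lambda>m\<in>{..<?m}. v m + t m)"
    have inj: "inj_on \<tau> ({..<?m} \<rightarrow>\<^sub>E UNIV)"
    proof (rule inj_onI)
      fix v w assume vw: "v \<in> {..<?m} \<rightarrow>\<^sub>E UNIV" "w \<in> {..<?m} \<rightarrow>\<^sub>E UNIV" "\<tau> v = \<tau> w"
      have "v m = w m" if "m < ?m" for m
        using fun_cong[OF vw(3), of m] that by (simp add: \<tau>_def)
      then show "v = w" using vw by (intro PiE_ext) auto
    qed
    have sub: "\<tau> ` ({..<?m} \<rightarrow>\<^sub>E UNIV) \<subseteq> {..<?m} \<rightarrow>\<^sub>E UNIV" by (auto simp: \<tau>_def)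
    have g: "g (\<tau> v) = g v" for v
      using t(2) unfolding g_def node_contents_eq_iff
      by (simp add: coded_unit_eq_sum \<tau>_def distrib_left sum.distrib)
    have f: "f (\<tau> v) = a'" if "f v = a" for v
    proof
      fix j
      show "f (\<tau> v) j = a' j"
      proof (cases "j \<in> B")
        case True
        then have "pos j < ?m" "v (pos j) = a j"
          using B(3) that by (auto simp: f_def)
        then show ?thesis using True t_pos by (simp add: f_def \<tau>_def)
      next
        case False
        \<comment> \<open>Outside \<open>B\<close> both sides have the default value
          \<open>undefined\<close>, because \<open>a'\<close> is itself a value of
          \<open>f\<close>.\<close>
        moreover obtain v' where "a' = f v'" using a(2) by blast
        ultimately show ?thesis by (simp add: f_def)
      qed
    qed
    show "\<exists>\<tau>. inj_on \<tau> ({..<?m} \<rightarrow>\<^sub>E UNIV) \<and>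
        \<tau> ` ({..<?m} \<rightarrow>\<^sub>E UNIV) \<subseteq> {..<?m} \<rightarrow>\<^sub>E UNIV \<and>
        (\<forall>v\<in>{..<?m} \<rightarrow>\<^sub>E UNIV. g (\<tau> v) = g v \<and> (f v = a \<longrightarrow> f (\<tau> v) = a'))"
      using inj sub g f by (metis (no_types, lifting))
  qed
  moreover have "f (\<lambda>m\<in>{..<?m}. X m w) = (\<lambda>j\<in>B. X (pos j) w)" for w
    using B(3) by (auto simp: f_def fun_eq_iff restrict_def)
  ultimately show ?thesis
    unfolding g_def node_contents_restrict[symmetric] by simp
qed

lemma card_observed_units:
  assumes "bij_betw e {..<N} edges"
  shows "card {j. j < N \<and> e j \<inter> E \<noteq> {}} = card {a \<in> edges. a \<inter> E \<noteq> {}}"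
proof (rule bij_betw_same_card[of e])
  show "bij_betw e {j. j < N \<and> e j \<inter> E \<noteq> {}} {a \<in> edges. a \<inter> E \<noteq> {}}"
    using assms unfolding bij_betw_def by (auto intro: inj_on_subset)
qed

text \<open>The masks are the coordinates in \<open>rnd\<close>, and \<open>pos\<close> runs through
  all others. This serves twice: to exclude incomplete graphs at strength \<open>lam\<close>, and to
  refute perfect security at strength \<open>l\<close>.\<close>

lemma randomized_rg_code_leak:
  fixes G :: "'f::{field,finite} mat"
  assumes code: "randomized_rg_code P n k d lam edges e G X rnd pos" and G: "cauchy_mat G"
    and lam: "lam < k" "k \<le> d"
    and E: "clique_units d lam < card {a \<in> edges. a \<inter> E \<noteq> {}}"
  shows "mutual_info P (\<lambda>w. \<lambda>j\<in>{..<clique_units d k - clique_units d lam}. X (pos j) w)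
           (\<lambda>w. \<lambda>i\<in>E. node_content e G X i w) > 0"
proof (rule mutual_info_node_contents_pos[where D = rnd])
  have dims: "dim_row G = n * d div 2" "dim_col G = clique_units d k"
    using code unfolding randomized_rg_code_def by auto
  show "iid_uniform P (dim_col G) X" "cauchy_mat G" "rnd \<subseteq> {..<dim_col G}"
      "pos ` {..<clique_units d k - clique_units d lam} = {..<dim_col G} - rnd"
    using code G unfolding dims randomized_rg_code_def bij_betw_def by auto
  \<comment> \<open>At least one data unit exists because \<open>lam < k\<close>.\<close>
  show "card rnd < dim_col G"
    using code clique_units_strict_mono[OF lam] unfolding dims randomized_rg_code_def by auto
  show "card rnd < card {j. j < dim_row G \<and> e j \<inter> E \<noteq> {}}"
    using code E card_observed_units[of e "n * d div 2" edges E]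
    unfolding dims randomized_rg_code_def by auto
qed

text \<open>A non-edge inside a set of \<open>lam\<close> nodes would expose one unit more than the \<open>clique_units d lam\<close>
  random units can mask.\<close>

lemma perfectly_secure_imp_complete:
  fixes G :: "'f::{field,finite} mat"
  assumes code: "randomized_rg_code P n k d lam edges e G X rnd pos" and G: "cauchy_mat G"
    and lam: "2 \<le> lam" "lam < k" "k \<le> d" "d \<le> n - 1"
    and secure: "perfectly_secure P n (clique_units d k - clique_units d lam)
           (\<lambda>j. X (pos j)) (node_content e G X) lam"
  shows "{a. a \<subseteq> {..<n} \<and> card a = 2} \<subseteq> edges"
proof (rule ccontr)
  assume "\<not> ?thesis"
  then obtain a where a: "a \<subseteq> {..<n}" "card a = 2" "a \<notin> edges" by auto
  have "card a \<le> lam" "lam \<le> card {..<n}" using a lam by auto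
  then obtain E where E: "a \<subseteq> E" "E \<subseteq> {..<n}" "card E = lam"
    using exists_subset_between[of a lam "{..<n}"] a by auto
  have reg: "regular_simple_graph n d edges" using code by (simp add: randomized_rg_code_def)
  have "clique_units d lam < card {a \<in> edges. a \<inter> E \<noteq> {}}"
    using clique_units_less_card_meeting[OF reg E(2) _ E(1) a(2,3)] E lam by simp
  from randomized_rg_code_leak[OF code G lam(2,3) this] secure E
  show False by (auto simp: perfectly_secure_def)
qed

theorem corollary5:
  fixes P :: "'w measure"
    and n k d lam :: nat
    and edges :: "nat set set" and e :: "nat \<Rightarrow> nat set"
    and G :: "'f::{field,finite} mat"
    and X :: "nat \<Rightarrow> 'w \<Rightarrow> 'f"
    and rnd :: "nat set" and pos :: "nat \<Rightarrow> nat"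
  assumes "1 \<le> k" and "k \<le> d" and "d \<le> n - 1" and "even (n * d)"
    and "1 \<le> lam" and "lam < k"
    and "randomized_rg_code P n k d lam edges e G X rnd pos"
    and "perfectly_secure P n (clique_units d k - clique_units d lam)
           (\<lambda>j. X (pos j)) (node_content e G X) lam"
    and "cauchy_mat G"
  shows "\<forall>l. lam < l \<and> l < k \<longrightarrow>
     \<not> perfectly_secure P n (clique_units d k - clique_units d lam)
         (\<lambda>j. X (pos j)) (node_content e G X) l \<and>
     (2 \<le> lam \<or> d = n - 1 \<longrightarrow>
        block_secure P n (clique_units d k - clique_units d lam)
          (\<lambda>j. X (pos j)) (node_content e G X) (clique_units d k - clique_units d l) l) \<and>
     real (clique_units d k - clique_units d l)
       = (real k - real l) * (real d - (real k + real l - 1) / 2)"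
proof (intro allI impI conjI)
  fix l assume "lam < l \<and> l < k"
  then have l: "lam < l" "l < k" by auto
  note code = assms(7) and G = assms(9)
  have reg: "regular_simple_graph n d edges" and bij: "bij_betw e {..<n * d div 2} edges"
    and dims: "dim_row G = n * d div 2" "dim_col G = clique_units d k"
    and iid: "iid_uniform P (dim_col G) X"
    and pos: "bij_betw pos {..<clique_units d k - clique_units d lam} ({..<dim_col G} - rnd)"
    using code unfolding randomized_rg_code_def by auto
  have le: "clique_units d l \<le> clique_units d k"
    using l assms(2) by (intro clique_units_mono) auto
  show "\<not> perfectly_secure P n (clique_units d k - clique_units d lam)
         (\<lambda>j. X (pos j)) (node_content e G X) l"
  proof
    assume secure: "perfectly_secure P n (clique_units d k - clique_units d lam)
         (\<lambda>j. X (pos j)) (node_content e G X) l"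
    \<comment> \<open>Any set of \<open>l\<close> nodes would do: whatever the edges between them,
      they see at least \<open>clique_units d l\<close> units, more than there are random
      ones.\<close>
    have E: "{..<l} \<subseteq> {..<n}" using l assms(2,3) by auto
    have "clique_units d lam < clique_units d l"
      using l assms(2) by (intro clique_units_strict_mono) auto
    also have "\<dots> \<le> card {a \<in> edges. a \<inter> {..<l} \<noteq> {}}"
      using clique_units_le_card_meeting[OF reg E] by simp
    finally show False
      using randomized_rg_code_leak[OF code G assms(6,2)] secure E
      by (fastforce simp: perfectly_secure_def)
  qed
  show "real (clique_units d k - clique_units d l)
       = (real k - real l) * (real d - (real k + real l - 1) / 2)"
    using le l assms(2) by (simp add: of_nat_diff real_clique_units field_simps)
  assume "2 \<le> lam \<or> d = n - 1"
  \<comment> \<open>For \<open>2 \<le> lam\<close> completeness comes from perfect security at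
    strength \<open>lam\<close>, for \<open>d = n - 1\<close> from the degrees.\<close>
  then have complete: "{a. a \<subseteq> {..<n} \<and> card a = 2} \<subseteq> edges"
    using perfectly_secure_imp_complete[OF code G _ assms(6,2,3,8)]
      regular_simple_graph_complete[of n edges] reg by blast
  show "block_secure P n (clique_units d k - clique_units d lam)
          (\<lambda>j. X (pos j)) (node_content e G X) (clique_units d k - clique_units d l) l"
    unfolding block_secure_def
  proof (intro allI impI)
    fix B E assume B: "B \<subseteq> {..<clique_units d k - clique_units d lam}"
        "card B \<le> clique_units d k - clique_units d l"
      and E: "E \<subseteq> {..<n}" "card E \<le> l"
    have "card {j. j < dim_row G \<and> e j \<inter> E \<noteq> {}} = clique_units d (card E)"
      using card_observed_units[OF bij] card_meeting_eq_clique_units[OF reg E(1) complete]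
      by (simp add: dims)
    \<comment> \<open>Fewer than \<open>l\<close> nodes see no more units, and the bound on
      \<open>card B\<close> is exactly what \<open>clique_units d l\<close> observed rows leave of
      the columns.\<close>
    also have "\<dots> \<le> clique_units d l"
      using E l assms(2) by (intro clique_units_mono) auto
    finally have "card {j. j < dim_row G \<and> e j \<inter> E \<noteq> {}} + card B \<le> dim_col G"
      using B le by (simp add: dims)
    moreover have "inj_on pos B" "pos ` B \<subseteq> {..<dim_col G}" "finite B"
      using pos B(1) finite_subset[OF B(1)] by (auto simp: bij_betw_def intro: inj_on_subset)
    ultimately show "mutual_info P (\<lambda>w. \<lambda>j\<in>B. X (pos j) w) (\<lambda>w. \<lambda>i\<in>E. node_content e G X i w) = 0"
      by (intro mutual_info_node_contents_eq_0[OF iid G])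
  qed
qed

end
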